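(* Let $1\le t\le n$ and let $\mathcal{C}\subseteq\mathbb{S}_n$ be a $t$-balanced code. Define $X_{0,t}=\{t+1,\dots,n\}$, $X_{n-t,t}=\{1,\dots,n-t\}$, and $X_{s,t}=\{1,\dots,s,\,t+s+1,\dots,n\}$ for $1\le s\le n-t-1$. Then for every ordered sequence $\mathcal{I}=(i_1,\dots,i_{n-t})$ of pairwise distinct elements of $[n]$ and every $0\le s\le n-t$, there exists a unique codeword $\sigma\in\mathcal{C}$ such that for all $j\in X_{s,t}$, $$\sigma(j)=\begin{cases} i_j & \text{if } j\le s,\\ i_{j-t} & \text{if } j>s.\end{cases}$$
   Context: $\mathbb{S}_n$ is the group of permutations of $[n]=\{1,\dots,n\}$, written in one-line notation. The Kendall-$\tau$ distance $\mathrm{d}_\mathrm{K}(\sigma,\tau)$ is the minimum number of adjacent transpositions (swaps of two consecutive entries in one-line notation) needed to obtain $\sigma$ from $\tau$. A code is a subset $\mathcal{C}\subseteq\mathbb{S}_n$ with $|\mathcal{C}|\ge2$, with minimum distance $\mathrm{d}_\mathrm{K}(\mathcal{C})=\min\{\mathrm{d}_\mathrm{K}(\sigma,\tau):\sigma\ne\tau\in\mathcal{C}\}$. A code $\mathcal{C}\subseteq\mathbb{S}_n$ is $t$-balanced if $\mathrm{d}_\mathrm{K}(\mathcal{C})>\binom{t}{2}$ and $|\mathcal{C}|=n!/t!$. *)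

theory Defs
  imports Complex_Main "HOL-Combinatorics.Permutations"
begin

text \<open>
  A permutation of \<open>[n]\<close> is a function \<open>\<sigma>\<close> with \<open>\<sigma> permutes {1..n}\<close>; its one-line notation is
  \<open>\<sigma> 1, \<dots>, \<sigma> n\<close>. Swapping the entries in positions \<open>i\<close> and \<open>i + 1\<close> is composition with a
  transposition on the right.
\<close>

definition adjacent_swap :: "nat \<Rightarrow> ((nat \<Rightarrow> nat) \<times> (nat \<Rightarrow> nat)) set" where
  "adjacent_swap n =
     {(\<tau>, \<sigma>). \<tau> permutes {1..n} \<and> (\<exists>i. 1 \<le> i \<and> i < n \<and> \<sigma> = \<tau> \<circ> transpose i (i + 1))}"

definition kendall_dist :: "nat \<Rightarrow> (nat \<Rightarrow> nat) \<Rightarrow> (nat \<Rightarrow> nat) \<Rightarrow> nat" where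
  "kendall_dist n \<sigma> \<tau> = (LEAST k. (\<tau>, \<sigma>) \<in> adjacent_swap n ^^ k)"

definition perm_code :: "nat \<Rightarrow> (nat \<Rightarrow> nat) set \<Rightarrow> bool" where
  "perm_code n C \<longleftrightarrow> C \<subseteq> {\<sigma>. \<sigma> permutes {1..n}} \<and> 2 \<le> card C"

definition min_dist :: "nat \<Rightarrow> (nat \<Rightarrow> nat) set \<Rightarrow> nat" where
  "min_dist n C = Min {kendall_dist n \<sigma> \<tau> | \<sigma> \<tau>. \<sigma> \<in> C \<and> \<tau> \<in> C \<and> \<sigma> \<noteq> \<tau>}"

definition balanced_code :: "nat \<Rightarrow> nat \<Rightarrow> (nat \<Rightarrow> nat) set \<Rightarrow> bool" where
  "balanced_code n t C \<longleftrightarrow>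
     perm_code n C \<and> t choose 2 < min_dist n C \<and> real (card C) = fact n / fact t"

definition X_set :: "nat \<Rightarrow> nat \<Rightarrow> nat \<Rightarrow> nat set" where
  "X_set n s t =
     (if s = 0 then {t + 1..n}
      else if s = n - t then {1..n - t}
      else {1..s} \<union> {t + s + 1..n})"

end

theory Submission
  imports Defs "HOL-Library.FuncSet"
begin

text \<open>
  Two permutations that agree outside a window of \<open>t\<close> consecutive positions are at Kendall distance
  at most \<open>t choose 2\<close>: bubble the correct value into the last position of the window and recurse on
  the first \<open>t - 1\<close> positions. Hence the codewords of a \<open>t\<close>-balanced code are determined by their
  entries outside the window. There are exactly \<open>n! / t!\<close> injective fillings of those \<open>n - t\<close>
  positions, which is the size of the code, so every filling occurs.
\<close>

lemma adjacent_swap_permutes: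
  assumes "(\<tau>, \<sigma>) \<in> adjacent_swap n"
  shows "\<sigma> permutes {1..n}"
  using assms unfolding adjacent_swap_def
  by (auto intro!: permutes_compose permutes_swap_id)

lemma adjacent_swap_relpow_permutes:
  assumes "(\<tau>, \<sigma>) \<in> adjacent_swap n ^^ k" and "\<tau> permutes {1..n}"
  shows "\<sigma> permutes {1..n}"
  using assms by (cases k) (auto dest: adjacent_swap_permutes)

text \<open>One pass of bubble sort: each swap carries the entry \<open>\<tau> p\<close> one
  position to the right. The entries it passes shift left by one. The exact count
  \<open>q - p\<close> is what later adds up to a binomial coefficient.\<close>

lemma adjacent_swaps_move_entry:
  assumes "\<tau> permutes {1..n}" and "1 \<le> p" and "p \<le> q" and "q \<le> n"
  shows "\<exists>\<tau>'. (\<tau>, \<tau>') \<in> adjacent_swap n ^^ (q - p) \<and> \<tau>' q = \<tau> p \<and> (\<forall>j. j \<notin> {p..q} \<longrightarrow> \<tau>' j = \<tau> j)"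
  using assms(3,4)
proof (induction q rule: dec_induct)
  case base
  then show ?case by auto
next
  case (step q)
  then obtain \<tau>' where \<tau>': "(\<tau>, \<tau>') \<in> adjacent_swap n ^^ (q - p)" "\<tau>' q = \<tau> p"
    "\<forall>j. j \<notin> {p..q} \<longrightarrow> \<tau>' j = \<tau> j"
    by auto
  define \<tau>'' where "\<tau>'' = \<tau>' \<circ> transpose q (q + 1)"
  have "\<tau>' permutes {1..n}"
    using \<tau>'(1) assms(1) by (rule adjacent_swap_relpow_permutes)
  then have "(\<tau>', \<tau>'') \<in> adjacent_swap n"
    using step.hyps(1) step.prems assms(2)
    by (auto simp: adjacent_swap_def \<tau>''_def intro!: exI[of _ q])
  with \<tau>'(1) have "(\<tau>, \<tau>'') \<in> adjacent_swap n ^^ (Suc q - p)"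
    using step.hyps by (auto simp: Suc_diff_le)
  moreover have "\<tau>'' (Suc q) = \<tau> p"
    using \<tau>'(2) by (simp add: \<tau>''_def)
  moreover have "\<forall>j. j \<notin> {p..Suc q} \<longrightarrow> \<tau>'' j = \<tau> j"
    using \<tau>'(3) step.hyps by (auto simp: \<tau>''_def transpose_def)
  ultimately show ?case by blast
qed

text \<open>A pass over a window of length \<open>t\<close> costs at most \<open>t - 1\<close> swaps
  and leaves a window of length \<open>t - 1\<close>, so the total is at most (t - 1) + ... + 1 + 0.
  The induction varies \<open>\<tau>\<close> because each pass replaces it, while the target
  \<open>\<sigma>\<close> stays fixed.\<close>

lemma adjacent_swaps_sort_window:
  assumes "\<sigma> permutes {1..n}" and "\<tau> permutes {1..n}" and "s + t \<le> n"
    and "\<And>j. j \<notin> {s + 1..s + t} \<Longrightarrow> \<sigma> j = \<tau> j"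
  shows "\<exists>k \<le> t choose 2. (\<tau>, \<sigma>) \<in> adjacent_swap n ^^ k"
  using assms(2-)
proof (induction t arbitrary: \<tau>)
  case 0
  then have "\<sigma> = \<tau>" by auto
  then show ?case by auto
next
  case (Suc m)
  define q where "q = s + Suc m"
  obtain p where p: "\<tau> p = \<sigma> q"
    using Suc.prems(1) by (metis permutes_inverses(1))
  \<comment> \<open>Outside the window both permutations agree, so the entry wanted at
    \<open>q\<close> cannot sit there: injectivity of \<open>\<sigma>\<close> would force
    \<open>p = q\<close>, which lies in the window.\<close>
  have p_window: "p \<in> {s + 1..q}"
  proof (rule ccontr)
    assume "p \<notin> {s + 1..q}"
    then have "\<sigma> p = \<sigma> q"
      using Suc.prems(3)[of p] p by (simp add: q_def)
    then have "p = q"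
      using assms(1) by (metis permutes_inverses(2))
    with \<open>p \<notin> {s + 1..q}\<close> show False by (simp add: q_def)
  qed
  with adjacent_swaps_move_entry[OF Suc.prems(1), of p q] Suc.prems(2)
  obtain \<tau>' where \<tau>': "(\<tau>, \<tau>') \<in> adjacent_swap n ^^ (q - p)" "\<tau>' q = \<tau> p"
    "\<forall>j. j \<notin> {p..q} \<longrightarrow> \<tau>' j = \<tau> j"
    by (auto simp: q_def)
  have "\<sigma> j = \<tau>' j" if "j \<notin> {s + 1..s + m}" for j
  proof (cases "j = q")
    case True
    then show ?thesis using \<tau>'(2) p by simp
  next
    case False
    with that have "j \<notin> {s + 1..q}" by (auto simp: q_def)
    moreover from this have "j \<notin> {p..q}" using p_window by auto
    ultimately show ?thesis
      using \<tau>'(3) Suc.prems(3)[of j] by (simp add: q_def)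
  qed
  with Suc.IH[of \<tau>'] Suc.prems(2) adjacent_swap_relpow_permutes[OF \<tau>'(1) Suc.prems(1)]
  obtain k where k: "k \<le> m choose 2" "(\<tau>', \<sigma>) \<in> adjacent_swap n ^^ k"
    by auto
  from \<tau>'(1) k(2) have "(\<tau>, \<sigma>) \<in> adjacent_swap n ^^ (q - p + k)"
    by (auto simp: relpow_add)
  \<comment> \<open>Pascal's rule gives m + (m choose 2); unfolding the numeral 2 to successors lets
    the recursion of \<open>choose\<close> apply.\<close>
  moreover have "q - p + k \<le> Suc m choose 2"
  proof -
    have "q - p \<le> m" using p_window by (auto simp: q_def)
    with k(1) show ?thesis by (simp add: numeral_2_eq_2)
  qed
  ultimately show ?case by blast
qed

lemma kendall_dist_le_window:
  assumes "\<sigma> permutes {1..n}" and "\<tau> permutes {1..n}" and "s + t \<le> n"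
    and "\<And>j. j \<notin> {s + 1..s + t} \<Longrightarrow> \<sigma> j = \<tau> j"
  shows "kendall_dist n \<sigma> \<tau> \<le> t choose 2"
proof -
  obtain k where "k \<le> t choose 2" "(\<tau>, \<sigma>) \<in> adjacent_swap n ^^ k"
    using adjacent_swaps_sort_window[OF assms] by blast
  then show ?thesis
    unfolding kendall_dist_def by (meson Least_le order_trans)
qed

lemma min_dist_le_kendall_dist:
  assumes "finite C" and "\<sigma> \<in> C" and "\<tau> \<in> C" and "\<sigma> \<noteq> \<tau>"
  shows "min_dist n C \<le> kendall_dist n \<sigma> \<tau>"
proof -
  \<comment> \<open>\<open>Min\<close> bounds its elements from below only on a finite set, so
    finiteness of the set of distances comes first.\<close>
  have "{kendall_dist n \<sigma> \<tau> | \<sigma> \<tau>. \<sigma> \<in> C \<and> \<tau> \<in> C \<and> \<sigma> \<noteq> \<tau>}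
      \<subseteq> (\<lambda>(\<sigma>, \<tau>). kendall_dist n \<sigma> \<tau>) ` (C \<times> C)"
    by auto
  then have "finite {kendall_dist n \<sigma> \<tau> | \<sigma> \<tau>. \<sigma> \<in> C \<and> \<tau> \<in> C \<and> \<sigma> \<noteq> \<tau>}"
    using assms(1) by (meson finite_SigmaI finite_imageI finite_subset)
  then show ?thesis
    unfolding min_dist_def using assms(2-) by (intro Min_le) auto
qed

text \<open>Distinct codewords with this agreement could differ only inside a window of length
  \<open>t\<close>, which would put them closer together than the minimum distance.\<close>

lemma balanced_code_eqI:
  assumes "balanced_code n t C" and "\<sigma> \<in> C" and "\<tau> \<in> C" and "s + t \<le> n"
    and "\<And>j. j \<in> {1..s} \<union> {t + s + 1..n} \<Longrightarrow> \<sigma> j = \<tau> j"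
  shows "\<sigma> = \<tau>"
proof (rule ccontr)
  assume "\<sigma> \<noteq> \<tau>"
  \<comment> \<open>An infinite set has cardinality 0, so having at least two codewords makes
    \<open>C\<close> finite.\<close>
  have perms: "\<sigma> permutes {1..n}" "\<tau> permutes {1..n}" and "finite C"
    using assms(1-3) by (auto simp: balanced_code_def perm_code_def intro: card_ge_0_finite)
  have "\<sigma> j = \<tau> j" if "j \<notin> {s + 1..s + t}" for j
  proof (cases "j \<in> {1..n}")
    case True
    with that show ?thesis by (intro assms(5)) auto
  next
    case False
    then show ?thesis using perms by (simp add: permutes_not_in)
  qed
  then have "kendall_dist n \<sigma> \<tau> \<le> t choose 2"
    by (rule kendall_dist_le_window[OF perms assms(4)])
  with min_dist_le_kendall_dist[OF \<open>finite C\<close> assms(2,3) \<open>\<sigma> \<noteq> \<tau>\<close>, of n] assms(1)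
  show False by (simp add: balanced_code_def)
qed

text \<open>Since t! divides n!, the real quotient in the definition is the natural number
  quotient.\<close>

lemma balanced_code_card:
  assumes "balanced_code n t C" and "t \<le> n"
  shows "card C = fact n div fact t"
proof -
  have "real (card C) = real (fact n div fact t)"
    using assms by (simp add: balanced_code_def real_of_nat_div fact_dvd)
  then show ?thesis by (simp only: of_nat_eq_iff)
qed

lemma card_inj_on_funcsetE:
  assumes "finite A" and "finite B" and "card A \<le> card B"
  shows "card {f \<in> A \<rightarrow>\<^sub>E B. inj_on f A} = fact (card B) div fact (card B - card A)"
proof -
  \<comment> \<open>The falling factorial that counts injections, read in reverse order, is the
    product over an interval that equals the quotient of factorials.\<close>
  have "prod ((-) (card B)) {0..<card A} = \<Prod>{card B - card A + 1..card B}"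
    by (rule prod.reindex_bij_witness[of _ "(-) (card B)" "(-) (card B)"]) (use assms(3) in auto)
  then show ?thesis
    using card_inj_on_subset_funcset[OF assms(1,2) subset_refl] by (simp add: fact_div_fact)
qed

text \<open>The boundary cases fit the general formula because \<open>{1..0}\<close> and
  \<open>{n + 1..n}\<close> are empty.\<close>

lemma X_set_eq:
  assumes "t \<le> n" and "s \<le> n - t"
  shows "X_set n s t = {1..s} \<union> {t + s + 1..n}"
  using assms by (auto simp: X_set_def)

text \<open>
  The \<open>i\<close>-th position outside the window \<open>{s + 1..s + t}\<close> is \<open>i\<close> or \<open>i + t\<close>.
\<close>

lemma balanced_code_bij_betw:
  assumes "balanced_code n t C" and "t \<le> n" and "s \<le> n - t"
  shows "bij_betw (\<lambda>\<sigma>. \<lambda>i\<in>{1..n - t}. \<sigma> (if i \<le> s then i else i + t)) C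
    {f \<in> {1..n - t} \<rightarrow>\<^sub>E {1..n}. inj_on f {1..n - t}}"
    (is "bij_betw ?r C ?F")
proof -
  have perms: "\<sigma> permutes {1..n}" if "\<sigma> \<in> C" for \<sigma>
    using assms(1) that by (auto simp: balanced_code_def perm_code_def)
  have inj: "inj_on ?r C"
  proof (rule inj_onI)
    fix \<sigma> \<tau> assume C: "\<sigma> \<in> C" "\<tau> \<in> C" and eq: "?r \<sigma> = ?r \<tau>"
    show "\<sigma> = \<tau>"
    proof (rule balanced_code_eqI[OF assms(1) C])
      show "s + t \<le> n" using assms(2,3) by simp
    next
      fix j assume j: "j \<in> {1..s} \<union> {t + s + 1..n}"
      \<comment> \<open>The index belonging to position \<open>j\<close> is \<open>j\<close> or
        \<open>j - t\<close>; beyond the window \<open>j - t\<close> still exceeds \<open>s\<close>,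
        so the reindexing returns \<open>j\<close>.\<close>
      show "\<sigma> j = \<tau> j"
        using j fun_cong[OF eq, of "if j \<le> s then j else j - t"] assms(2,3)
        by (auto split: if_splits)
    qed
  qed
  have "?r ` C \<subseteq> ?F"
  proof (rule image_subsetI)
    fix \<sigma> assume "\<sigma> \<in> C"
    then have \<sigma>: "\<sigma> permutes {1..n}" by (rule perms)
    have "\<sigma> (if i \<le> s then i else i + t) \<in> {1..n}" if "i \<in> {1..n - t}" for i
      unfolding permutes_in_image[OF \<sigma>] using that assms(2) by auto
    then have "?r \<sigma> \<in> {1..n - t} \<rightarrow>\<^sub>E {1..n}"
      by (subst restrict_PiE_iff) blast
    moreover have "inj_on (?r \<sigma>) {1..n - t}"
    proof (rule inj_onI)
      fix i k assume "i \<in> {1..n - t}" "k \<in> {1..n - t}" "?r \<sigma> i = ?r \<sigma> k"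
      then have "\<sigma> (if i \<le> s then i else i + t) = \<sigma> (if k \<le> s then k else k + t)"
        by simp
      then have "(if i \<le> s then i else i + t) = (if k \<le> s then k else k + t)"
        by (rule injD[OF permutes_inj[OF \<sigma>]])
      then show "i = k" by (auto split: if_splits)
    qed
    ultimately show "?r \<sigma> \<in> ?F" by simp
  qed
  \<comment> \<open>Equal finite cardinalities turn the inclusion of the image into equality, which
    is surjectivity.\<close>
  moreover have "card (?r ` C) = card ?F"
    using assms(2) balanced_code_card[OF assms(1,2)] card_image[OF inj]
    by (simp add: card_inj_on_funcsetE)
  moreover have "finite ?F"
    by (simp add: finite_PiE)
  ultimately have "?r ` C = ?F"
    by (intro card_subset_eq)
  with inj show ?thesis by (simp add: bij_betw_def)
qed

theorem theorem4p2:
  fixes n t :: nat and C :: "(nat \<Rightarrow> nat) set"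
  assumes "1 \<le> t" and "t \<le> n"
    and "balanced_code n t C"
  shows "\<forall>\<I> :: nat \<Rightarrow> nat. inj_on \<I> {1..n - t} \<and> \<I> ` {1..n - t} \<subseteq> {1..n} \<longrightarrow>
           (\<forall>s. 0 \<le> s \<and> s \<le> n - t \<longrightarrow>
             (\<exists>!\<sigma>. \<sigma> \<in> C \<and>
               (\<forall>j \<in> X_set n s t. \<sigma> j = (if j \<le> s then \<I> j else \<I> (j - t)))))"
proof (intro allI impI)
  fix \<I> :: "nat \<Rightarrow> nat" and s :: nat
  assume \<I>: "inj_on \<I> {1..n - t} \<and> \<I> ` {1..n - t} \<subseteq> {1..n}" and "0 \<le> s \<and> s \<le> n - t"
  then have s: "s \<le> n - t" by simp
  let ?r = "\<lambda>\<sigma>. \<lambda>i\<in>{1..n - t}. \<sigma> (if i \<le> s then i else i + t) :: nat"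
  \<comment> \<open>The fillings counted above are extensional functions, so the sequence is
    restricted to its index set before the bijection is applied.\<close>
  have "restrict \<I> {1..n - t} \<in> {f \<in> {1..n - t} \<rightarrow>\<^sub>E {1..n}. inj_on f {1..n - t}}"
    using \<I> by (auto simp: restrict_PiE_iff)
  with balanced_code_bij_betw[OF assms(3,2) s]
  have ex1: "\<exists>!\<sigma>. \<sigma> \<in> C \<and> ?r \<sigma> = restrict \<I> {1..n - t}"
    unfolding bij_betw_def inj_on_def by (smt (verit) imageE)
  \<comment> \<open>Passing between indices \<open>i\<close> of the sequence and positions
    \<open>j\<close> outside the window turns the unique preimage into the codeword
    condition.\<close>
  have "?r \<sigma> = restrict \<I> {1..n - t} \<longleftrightarrow>
      (\<forall>j \<in> X_set n s t. \<sigma> j = (if j \<le> s then \<I> j else \<I> (j - t)))" for \<sigma>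
  proof
    assume eq: "?r \<sigma> = restrict \<I> {1..n - t}"
    show "\<forall>j \<in> X_set n s t. \<sigma> j = (if j \<le> s then \<I> j else \<I> (j - t))"
    proof
      fix j assume "j \<in> X_set n s t"
      then show "\<sigma> j = (if j \<le> s then \<I> j else \<I> (j - t))"
        using fun_cong[OF eq, of "if j \<le> s then j else j - t"] s assms(2)
        by (auto simp: X_set_eq split: if_splits)
    qed
  next
    assume eq: "\<forall>j \<in> X_set n s t. \<sigma> j = (if j \<le> s then \<I> j else \<I> (j - t))"
    show "?r \<sigma> = restrict \<I> {1..n - t}"
    proof (rule restrict_ext)
      fix i assume "i \<in> {1..n - t}"
      then show "\<sigma> (if i \<le> s then i else i + t) = \<I> i"
        using eq[rule_format, of "if i \<le> s then i else i + t"] s assms(2)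
        by (auto simp: X_set_eq split: if_splits)
    qed
  qed
  with ex1 show "\<exists>!\<sigma>. \<sigma> \<in> C \<and>
      (\<forall>j \<in> X_set n s t. \<sigma> j = (if j \<le> s then \<I> j else \<I> (j - t)))"
    by simp
qed

end
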